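(* Let $G$ be a finite group and $\mathbb{k}$ a field. For a $G$-graded $\mathbb{k}$-vector space $V$ and $g, g_0, g_1 \in G$ it holds $$(V^{g_0})_g = (V_{g^{-1}g_0})^{\star}.$$ Thus, if $V$ is finite-dimensional, there exists an isomorphism of vector spaces $$((V^{g_0})^{g_1})_g \cong V_{g_1^{-1} g g_0}.$$
   Context: A $G$-graded vector space is a direct sum $V = \bigoplus_{g \in G} V_g$ of $\mathbb{k}$-vector spaces; it is finite-dimensional if every $V_g$ is. $(-)^\star$ denotes the linear dual. $\mathbb{k}_{g_0}$ is the graded vector space with $(\mathbb{k}_{g_0})_{h} = \delta_{g_0,h}\,\mathbb{k}$. A linear map $f: V \to W$ is of degree $g$ if $f(V_h) \subseteq W_{gh}$ for all $h \in G$; $\mathrm{Hom}_g(V,W)$ is the space of such maps, and $\underline{\mathrm{Hom}}(V,W)$ is the $G$-graded vector space with $\underline{\mathrm{Hom}}(V,W)_g = \mathrm{Hom}_g(V,W)$. Define $V^{g_0} := \underline{\mathrm{Hom}}(V, \mathbb{k}_{g_0})$. The equality in the first display is the canonical identification given by restricting a degree-$g$ map $V \to \mathbb{k}_{g_0}$ to $V_{g^{-1}g_0}$. *)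

theory Defs
  imports "Jordan_Normal_Form.Missing_VectorSpace"
begin

record ('k, 'v, 'g) graded_space = "('k, 'v) module" +
  component :: "'g \<Rightarrow> 'v set"

text \<open>
  The graded space is the internal direct sum of its components: every vector is, in exactly one
  way, the sum of a finitely supported family of homogeneous vectors.
\<close>

locale graded_vector_space = G: group G + V: vectorspace K V
  for G :: "('g, 'a) monoid_scheme" (structure)
    and K :: "('k, 'b) ring_scheme"
    and V :: "('k, 'v, 'g, 'c) graded_space_scheme" +
  assumes component_subspace: "g \<in> carrier G \<Longrightarrow> subspace K (component V g) V"
    and direct_sum_components: "v \<in> carrier V \<Longrightarrow>
      \<exists>!c. c \<in> (\<Pi>\<^sub>E g\<in>carrier G. component V g) \<and>
          finite {g \<in> carrier G. c g \<noteq> \<zero>\<^bsub>V\<^esub>} \<and>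
          (\<Oplus>\<^bsub>V\<^esub> g \<in> {g \<in> carrier G. c g \<noteq> \<zero>\<^bsub>V\<^esub>}. c g) = v"

definition grade :: "('k, 'v, 'g, 'c) graded_space_scheme \<Rightarrow> 'g \<Rightarrow> ('k, 'v, 'g, 'c) graded_space_scheme"
  where "grade V g = V\<lparr>carrier := component V g\<rparr>"

definition fin_dim_graded ::
  "('g, 'a) monoid_scheme \<Rightarrow> ('k, 'b) ring_scheme \<Rightarrow> ('k, 'v, 'g, 'c) graded_space_scheme \<Rightarrow> bool"
  where "fin_dim_graded G K V \<longleftrightarrow> (\<forall>g\<in>carrier G. vectorspace.fin_dim K (grade V g))"

text \<open>
  Linear maps are taken extensional on the carrier of their domain, so that equal maps are equal
  as HOL functions. The fields \<open>mult\<close> and \<open>one\<close> of a module record play no role.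
\<close>

definition hom_space ::
  "('k, 'b) ring_scheme \<Rightarrow> ('k, 'v, 'c) module_scheme \<Rightarrow> ('k, 'w, 'd) module_scheme
    \<Rightarrow> ('k, 'v \<Rightarrow> 'w) module"
  where "hom_space K V W =
    \<lparr>carrier = module_hom K V W \<inter> extensional (carrier V),
     mult = (\<lambda>f f'. \<lambda>v\<in>carrier V. \<zero>\<^bsub>W\<^esub>),
     one = (\<lambda>v\<in>carrier V. \<zero>\<^bsub>W\<^esub>),
     zero = (\<lambda>v\<in>carrier V. \<zero>\<^bsub>W\<^esub>),
     add = (\<lambda>f f'. \<lambda>v\<in>carrier V. f v \<oplus>\<^bsub>W\<^esub> f' v),
     smult = (\<lambda>c f. \<lambda>v\<in>carrier V. c \<odot>\<^bsub>W\<^esub> f v)\<rparr>"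

definition self_module :: "('k, 'b) ring_scheme \<Rightarrow> ('k, 'k) module"
  where "self_module K =
    \<lparr>carrier = carrier K, mult = (\<otimes>\<^bsub>K\<^esub>), one = \<one>\<^bsub>K\<^esub>,
     zero = \<zero>\<^bsub>K\<^esub>, add = (\<oplus>\<^bsub>K\<^esub>), smult = (\<otimes>\<^bsub>K\<^esub>)\<rparr>"

definition dual_space ::
  "('k, 'b) ring_scheme \<Rightarrow> ('k, 'v, 'c) module_scheme \<Rightarrow> ('k, 'v \<Rightarrow> 'k) module"
  where "dual_space K V = hom_space K V (self_module K)"

definition degree_homs ::
  "('g, 'a) monoid_scheme \<Rightarrow> ('k, 'b) ring_scheme \<Rightarrow> ('k, 'v, 'g, 'c) graded_space_scheme
    \<Rightarrow> ('k, 'w, 'g, 'd) graded_space_scheme \<Rightarrow> 'g \<Rightarrow> ('v \<Rightarrow> 'w) set"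
  where "degree_homs G K V W g =
    {f \<in> carrier (hom_space K V W).
      \<forall>h\<in>carrier G. f ` component V h \<subseteq> component W (g \<otimes>\<^bsub>G\<^esub> h)}"

text \<open>
  Nonzero maps of pairwise distinct degrees are linearly independent, so the direct sum of the spaces
  \<open>degree_homs G K V W g\<close> is realised as their span inside the space of all linear maps.
\<close>

definition graded_hom ::
  "('g, 'a) monoid_scheme \<Rightarrow> ('k, 'b) ring_scheme \<Rightarrow> ('k, 'v, 'g, 'c) graded_space_scheme
    \<Rightarrow> ('k, 'w, 'g, 'd) graded_space_scheme \<Rightarrow> ('k, 'v \<Rightarrow> 'w, 'g) graded_space"
  where "graded_hom G K V W = (let H = hom_space K V W in
    \<lparr>carrier = module.span K H (\<Union>g\<in>carrier G. degree_homs G K V W g),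
     mult = (\<otimes>\<^bsub>H\<^esub>), one = \<one>\<^bsub>H\<^esub>,
     zero = \<zero>\<^bsub>H\<^esub>, add = (\<oplus>\<^bsub>H\<^esub>), smult = (\<odot>\<^bsub>H\<^esub>),
     component = degree_homs G K V W\<rparr>)"

definition graded_line :: "('k, 'b) ring_scheme \<Rightarrow> 'g \<Rightarrow> ('k, 'k, 'g) graded_space"
  where "graded_line K g\<^sub>0 =
    \<lparr>carrier = carrier K, mult = (\<otimes>\<^bsub>K\<^esub>), one = \<one>\<^bsub>K\<^esub>,
     zero = \<zero>\<^bsub>K\<^esub>, add = (\<oplus>\<^bsub>K\<^esub>), smult = (\<otimes>\<^bsub>K\<^esub>),
     component = (\<lambda>h. if h = g\<^sub>0 then carrier K else {\<zero>\<^bsub>K\<^esub>})\<rparr>"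

definition graded_dual ::
  "('g, 'a) monoid_scheme \<Rightarrow> ('k, 'b) ring_scheme \<Rightarrow> ('k, 'v, 'g, 'c) graded_space_scheme
    \<Rightarrow> 'g \<Rightarrow> ('k, 'v \<Rightarrow> 'k, 'g) graded_space"
  where "graded_dual G K V g\<^sub>0 = graded_hom G K V (graded_line K g\<^sub>0)"

definition linear_iso ::
  "('k, 'b) ring_scheme \<Rightarrow> ('k, 'v, 'c) module_scheme \<Rightarrow> ('k, 'w, 'd) module_scheme
    \<Rightarrow> ('v \<Rightarrow> 'w) \<Rightarrow> bool"
  where "linear_iso K V W f \<longleftrightarrow> linear_map K V W f \<and> bij_betw f (carrier V) (carrier W)"

end

theory Submission
  imports Defs
begin

text \<open>
  A functional of degree \<open>g\<close> into \<open>graded_line K g\<^sub>0\<close> vanishes on every component of \<open>V\<close> except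
  the one of degree \<open>inv g \<otimes> g\<^sub>0\<close>, so it is its restriction to that component extended along the
  homogeneous projection. As \<open>G\<close> is finite, every functional on \<open>V\<close> is the sum of such pieces;
  hence \<open>graded_dual G K V g\<^sub>0\<close> is again graded, restriction applies to it a second time, and the
  second claim reduces to evaluation into the double dual of one finite-dimensional component.
\<close>

section \<open>Change of record, and finite sums in modules\<close>

lemma vectorspace_cong:
  assumes "vectorspace K M" and "carrier N = carrier M" and "add N = add M"
    and "zero N = zero M" and "smult N = smult M"
  shows "vectorspace K N"
proof -
  interpret M: vectorspace K M by fact
  show ?thesis
  proof (rule vs_criteria)
    show "field K" ..
    show "\<forall>v\<in>carrier N. \<exists>neg_v\<in>carrier N. v \<oplus>\<^bsub>N\<^esub> neg_v = \<zero>\<^bsub>N\<^esub>"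
      using M.M.r_neg assms by (metis M.M.a_inv_closed)
  qed (auto simp: assms M.M.a_ac M.smult_assoc1 M.smult_l_distr M.smult_r_distr)
qed

text \<open>A finite sum is a product in the additive monoid, which is built from these three
  fields. Sums can thus be moved between \<open>self_module K\<close> and \<open>K\<close>, and
  between the graded dual and the dual space.\<close>

lemma finsum_cong_add_monoid:
  assumes "carrier N = carrier M" and "add N = add M" and "zero N = zero M"
  shows "finsum N c A = finsum M c A"
  using assms by (simp add: finsum_def finprod_def)

lemma module_hom_finsum:
  assumes M: "module K M" and N: "module K N" and f: "f \<in> module_hom K M N"
    and A: "finite A" and c: "c \<in> A \<rightarrow> carrier M"
  shows "f (finsum M c A) = finsum N (\<lambda>a. f (c a)) A"
proof -
  interpret mod_hom K M N f
    using M N f by (simp add: mod_hom_def mod_hom_axioms_def)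
  from A c show ?thesis
  proof (induction A)
    case (insert a A)
    then have "finsum N (\<lambda>a. f (c a)) (insert a A) = f (c a) \<oplus>\<^bsub>N\<^esub> finsum N (\<lambda>a. f (c a)) A"
      by (intro N.M.finsum_insert) auto
    with insert show ?case by (simp add: Pi_iff)
  qed simp
qed

lemma submodule_finsum_closed:
  assumes "submodule K N M" and A: "finite A" and c: "c \<in> A \<rightarrow> N"
  shows "finsum M c A \<in> N"
proof -
  interpret submodule K N M by fact
  interpret M: module K M by (rule module)
  from A c show ?thesis
    using subset by (induction A) (auto simp: Pi_iff subset_iff)
qed

section \<open>Spaces of linear maps and dual spaces\<close>

lemma hom_space_simps [simp]:
  "carrier (hom_space K V W) = module_hom K V W \<inter> extensional (carrier V)"
  "zero (hom_space K V W) = (\<lambda>v\<in>carrier V. \<zero>\<^bsub>W\<^esub>)"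
  "add (hom_space K V W) = (\<lambda>f f'. \<lambda>v\<in>carrier V. f v \<oplus>\<^bsub>W\<^esub> f' v)"
  "smult (hom_space K V W) = (\<lambda>c f. \<lambda>v\<in>carrier V. c \<odot>\<^bsub>W\<^esub> f v)"
  by (simp_all add: hom_space_def)

lemma self_module_simps [simp]:
  "carrier (self_module K) = carrier K" "zero (self_module K) = zero K"
  "add (self_module K) = add K" "smult (self_module K) = mult K"
  by (simp_all add: self_module_def)

lemma hom_space_vectorspace:
  assumes "vectorspace K V" and "vectorspace K W"
  shows "vectorspace K (hom_space K V W)"
proof -
  interpret K: field K using assms(1) by (simp add: vectorspace_def)
  interpret V: vectorspace K V by fact
  interpret W: vectorspace K W by fact
  \<comment> \<open>Commutativity of \<open>K\<close> enters here: it makes a scalar multiple of a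
    linear map compatible with scalars again.\<close>
  have smult_comm: "a \<odot>\<^bsub>W\<^esub> (b \<odot>\<^bsub>W\<^esub> w) = b \<odot>\<^bsub>W\<^esub> (a \<odot>\<^bsub>W\<^esub> w)"
    if "a \<in> carrier K" "b \<in> carrier K" "w \<in> carrier W" for a b w
    using that by (metis W.smult_assoc1 K.m_comm)
  show ?thesis
  proof (rule vs_criteria)
    show "field K" ..
    show "\<forall>f\<in>carrier (hom_space K V W). \<exists>f'\<in>carrier (hom_space K V W).
        f \<oplus>\<^bsub>hom_space K V W\<^esub> f' = \<zero>\<^bsub>hom_space K V W\<^esub>"
    proof
      fix f assume f: "f \<in> carrier (hom_space K V W)"
      then interpret mod_hom K V W f
        by (unfold_locales) simp
      have "(\<lambda>v\<in>carrier V. \<ominus>\<^bsub>W\<^esub> f v) \<in> carrier (hom_space K V W)"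
        by (auto simp: module_hom_def W.M.minus_add W.smult_r_minus)
      moreover have "f \<oplus>\<^bsub>hom_space K V W\<^esub> (\<lambda>v\<in>carrier V. \<ominus>\<^bsub>W\<^esub> f v) = \<zero>\<^bsub>hom_space K V W\<^esub>"
        by (auto simp: W.M.r_neg)
      ultimately show "\<exists>f'\<in>carrier (hom_space K V W).
        f \<oplus>\<^bsub>hom_space K V W\<^esub> f' = \<zero>\<^bsub>hom_space K V W\<^esub>" by blast
    qed
    \<comment> \<open>The left-hand side is \<open>undefined\<close> off \<open>carrier V\<close>,
      so equality with \<open>f\<close> rests on \<open>f\<close> being extensional; likewise for
      the unit law below.\<close>
    show "\<forall>f\<in>carrier (hom_space K V W). f \<oplus>\<^bsub>hom_space K V W\<^esub> \<zero>\<^bsub>hom_space K V W\<^esub> = f"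
      by (auto simp: module_hom_def Pi_iff intro!: extensionalityI[of _ "carrier V"])
    show "\<forall>f\<in>carrier (hom_space K V W). \<one>\<^bsub>K\<^esub> \<odot>\<^bsub>hom_space K V W\<^esub> f = f"
      by (auto simp: module_hom_def Pi_iff intro!: extensionalityI[of _ "carrier V"])
  qed (auto simp: module_hom_def Pi_iff W.M.a_ac W.smult_assoc1 W.smult_l_distr W.smult_r_distr
        smult_comm restrict_def extensional_def)
qed

lemma self_module_vectorspace:
  assumes "field K" shows "vectorspace K (self_module K)"
proof -
  interpret field K by fact
  show ?thesis
  proof (rule vs_criteria)
    show "\<forall>v\<in>carrier (self_module K). \<exists>neg_v\<in>carrier (self_module K).
        v \<oplus>\<^bsub>self_module K\<^esub> neg_v = \<zero>\<^bsub>self_module K\<^esub>"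
      using r_neg by auto
  qed (auto simp: a_ac m_assoc l_distr r_distr field_axioms)
qed

lemma dual_space_vectorspace: "vectorspace K V \<Longrightarrow> vectorspace K (dual_space K V)"
  unfolding dual_space_def
  by (intro hom_space_vectorspace self_module_vectorspace) (simp_all add: vectorspace_def)

lemma dual_space_carrier:
  "carrier (dual_space K V) = module_hom K V (self_module K) \<inter> extensional (carrier V)"
  by (simp add: dual_space_def)

lemma dual_space_apply:
  assumes "f \<in> carrier (dual_space K V)"
  shows "v \<in> carrier V \<Longrightarrow> f v \<in> carrier K"
    and "v \<in> carrier V \<Longrightarrow> w \<in> carrier V \<Longrightarrow> f (v \<oplus>\<^bsub>V\<^esub> w) = f v \<oplus>\<^bsub>K\<^esub> f w"
    and "a \<in> carrier K \<Longrightarrow> v \<in> carrier V \<Longrightarrow> f (a \<odot>\<^bsub>V\<^esub> v) = a \<otimes>\<^bsub>K\<^esub> f v"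
    and "f \<in> extensional (carrier V)"
  using assms by (auto simp: dual_space_carrier module_hom_def)

lemma dual_spaceI:
  assumes "\<And>v. v \<in> carrier V \<Longrightarrow> f v \<in> carrier K"
    and "\<And>v w. v \<in> carrier V \<Longrightarrow> w \<in> carrier V \<Longrightarrow> f (v \<oplus>\<^bsub>V\<^esub> w) = f v \<oplus>\<^bsub>K\<^esub> f w"
    and "\<And>a v. a \<in> carrier K \<Longrightarrow> v \<in> carrier V \<Longrightarrow> f (a \<odot>\<^bsub>V\<^esub> v) = a \<otimes>\<^bsub>K\<^esub> f v"
    and "f \<in> extensional (carrier V)"
  shows "f \<in> carrier (dual_space K V)"
  using assms by (auto simp: dual_space_carrier module_hom_def)

lemma dual_space_simps [simp]:
  "zero (dual_space K V) = (\<lambda>v\<in>carrier V. \<zero>\<^bsub>K\<^esub>)"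
  "add (dual_space K V) = (\<lambda>f f'. \<lambda>v\<in>carrier V. f v \<oplus>\<^bsub>K\<^esub> f' v)"
  "smult (dual_space K V) = (\<lambda>c f. \<lambda>v\<in>carrier V. c \<otimes>\<^bsub>K\<^esub> f v)"
  by (simp_all add: dual_space_def)

section \<open>Composition, inverses and transposes of linear isomorphisms\<close>

lemma linear_isoI:
  assumes "vectorspace K V" and "vectorspace K W" and "f \<in> module_hom K V W"
    and "bij_betw f (carrier V) (carrier W)"
  shows "linear_iso K V W f"
  using assms
  by (simp add: linear_iso_def linear_map_def mod_hom_def mod_hom_axioms_def vectorspace_def)

lemma linear_isoD:
  assumes "linear_iso K V W f"
  shows "vectorspace K V" and "vectorspace K W" and "f \<in> module_hom K V W"
    and "bij_betw f (carrier V) (carrier W)"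
  using assms
  by (simp_all add: linear_iso_def linear_map_def mod_hom_def mod_hom_axioms_def)

lemma linear_iso_trans:
  assumes f: "linear_iso K U V f" and h: "linear_iso K V W h"
  shows "linear_iso K U W (h \<circ> f)"
proof (rule linear_isoI)
  show "h \<circ> f \<in> module_hom K U W"
    using linear_isoD(3)[OF f] linear_isoD(3)[OF h] by (auto simp: module_hom_def Pi_iff)
  show "bij_betw (h \<circ> f) (carrier U) (carrier W)"
    using linear_isoD(4)[OF f] linear_isoD(4)[OF h] by (rule bij_betw_trans)
qed (use linear_isoD f h in blast)+

lemma linear_iso_inverse:
  assumes f: "linear_iso K V W f"
  shows "linear_iso K W V (the_inv_into (carrier V) f)"
proof (rule linear_isoI)
  note f' = linear_isoD[OF f]
  interpret V: vectorspace K V by (rule f')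
  interpret W: vectorspace K W by (rule f')
  let ?h = "the_inv_into (carrier V) f"
  have inj: "inj_on f (carrier V)" and im: "f ` carrier V = carrier W"
    using f'(4) by (auto simp: bij_betw_def)
  show bij: "bij_betw ?h (carrier W) (carrier V)"
    using f'(4) by (rule bij_betw_the_inv_into)
  have h: "?h w \<in> carrier V" if "w \<in> carrier W" for w
    using bij that by (auto simp: bij_betw_def)
  have fh: "f (?h w) = w" if "w \<in> carrier W" for w
    using inj im that by (simp add: f_the_inv_into_f)
  \<comment> \<open>By injectivity, \<open>?h w\<close> is recognised from the single equation
    \<open>f v = w\<close>; each linearity law of \<open>?h\<close> then reduces to the same law for
    \<open>f\<close>.\<close>
  have eq: "?h w = v" if "v \<in> carrier V" "f v = w" for v w
    using inj that by (auto simp: the_inv_into_f_f)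
  show "?h \<in> module_hom K W V"
    using h fh f'(3) by (auto simp: module_hom_def intro!: eq)
qed (use linear_isoD f in blast)+

text \<open>The transpose of an isomorphism is inverted by the transpose of the inverse.\<close>

lemma linear_iso_dual:
  assumes f: "linear_iso K V W f"
  shows "linear_iso K (dual_space K W) (dual_space K V) (\<lambda>\<phi>. \<lambda>v\<in>carrier V. \<phi> (f v))"
proof (rule linear_isoI)
  note f' = linear_isoD[OF f]
  interpret V: vectorspace K V by (rule f')
  interpret W: vectorspace K W by (rule f')
  have inj: "inj_on f (carrier V)" and im: "f ` carrier V = carrier W"
    using f'(4) by (auto simp: bij_betw_def)
  let ?h = "the_inv_into (carrier V) f"
  \<comment> \<open>Stated for arbitrary spaces because it serves twice: for \<open>f\<close>, and
    for its inverse in the opposite direction.\<close>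
  have pull: "(\<lambda>v\<in>carrier U. \<phi> (t v)) \<in> carrier (dual_space K U)"
    if t: "t \<in> module_hom K U U'" and \<phi>: "\<phi> \<in> carrier (dual_space K U')" and U: "vectorspace K U"
    for U :: "('a, 'p, 'q) module_scheme" and U' :: "('a, 'r, 's) module_scheme" and t \<phi>
  proof -
    interpret U: vectorspace K U by (rule U)
    show ?thesis
      using t \<phi> by (intro dual_spaceI) (auto simp: module_hom_def dual_space_apply Pi_iff)
  qed
  have hf: "?h (f v) = v" if "v \<in> carrier V" for v
    using inj that by (rule the_inv_into_f_f)
  have fh: "f (?h w) = w" if "w \<in> carrier W" for w
    using inj im that by (simp add: f_the_inv_into_f)
  have fc: "f v \<in> carrier W" if "v \<in> carrier V" for v using im that by auto
  have hc: "?h w \<in> carrier V" if "w \<in> carrier W" for w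
    using inj im that by (simp add: the_inv_into_into)
  show "(\<lambda>\<phi>. \<lambda>v\<in>carrier V. \<phi> (f v)) \<in> module_hom K (dual_space K W) (dual_space K V)"
    using pull[OF f'(3) _ f'(1)] fc
    by (auto simp: module_hom_def[of K "dual_space K W"])
  show "bij_betw (\<lambda>\<phi>. \<lambda>v\<in>carrier V. \<phi> (f v)) (carrier (dual_space K W)) (carrier (dual_space K V))"
  proof (rule bij_betw_byWitness[where f' = "\<lambda>\<psi>. \<lambda>w\<in>carrier W. \<psi> (?h w)"])
    show "(\<lambda>\<phi>. \<lambda>v\<in>carrier V. \<phi> (f v)) ` carrier (dual_space K W) \<subseteq> carrier (dual_space K V)"
      using pull[OF f'(3) _ f'(1)] by blast
    show "(\<lambda>\<psi>. \<lambda>w\<in>carrier W. \<psi> (?h w)) ` carrier (dual_space K V) \<subseteq> carrier (dual_space K W)"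
      using pull[OF linear_isoD(3)[OF linear_iso_inverse[OF f]] _ f'(2)] by blast
  qed (auto simp: hf fh fc hc dual_space_apply(4) intro!: extensionalityI[of _ "carrier V"] extensionalityI[of _ "carrier W"])
qed (use dual_space_vectorspace linear_isoD f in blast)+


section \<open>Functionals and finite sums\<close>

lemma dual_space_eval_hom:
  assumes "v \<in> carrier V"
  shows "(\<lambda>f. f v) \<in> module_hom K (dual_space K V) (self_module K)"
  using assms by (auto simp: module_hom_def dual_space_apply)

text \<open>Evaluation at \<open>v\<close> is linear, hence commutes with finite sums of
  functionals.\<close>

lemma dual_space_finsum_apply:
  assumes V: "vectorspace K V" and "finite A" and "c \<in> A \<rightarrow> carrier (dual_space K V)"
    and "v \<in> carrier V"
  shows "finsum (dual_space K V) c A v = finsum K (\<lambda>a. c a v) A"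
proof -
  have "module K (dual_space K V)" "module K (self_module K)"
    using dual_space_vectorspace[OF V] self_module_vectorspace[of K] V
    by (auto simp: vectorspace_def)
  from module_hom_finsum[OF this dual_space_eval_hom[OF assms(4)] assms(2,3)]
  show ?thesis by (simp add: finsum_cong_add_monoid[of "self_module K" K])
qed

lemma dual_space_apply_zero:
  assumes "vectorspace K V" and f: "f \<in> carrier (dual_space K V)"
  shows "f \<zero>\<^bsub>V\<^esub> = \<zero>\<^bsub>K\<^esub>"
proof -
  interpret V: vectorspace K V by fact
  have "f (\<zero>\<^bsub>K\<^esub> \<odot>\<^bsub>V\<^esub> \<zero>\<^bsub>V\<^esub>) = \<zero>\<^bsub>K\<^esub> \<otimes>\<^bsub>K\<^esub> f \<zero>\<^bsub>V\<^esub>"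
    by (intro dual_space_apply[OF f]) simp_all
  then show ?thesis by (simp add: dual_space_apply(1)[OF f])
qed

lemma dual_space_apply_finsum:
  assumes V: "vectorspace K V" and f: "f \<in> carrier (dual_space K V)"
    and "finite A" and "c \<in> A \<rightarrow> carrier V"
  shows "f (finsum V c A) = finsum K (\<lambda>a. f (c a)) A"
proof -
  have "module K V" "module K (self_module K)"
    using self_module_vectorspace[of K] V by (auto simp: vectorspace_def)
  moreover have "f \<in> module_hom K V (self_module K)" using f by (simp add: dual_space_carrier)
  ultimately have "f (finsum V c A) = finsum (self_module K) (\<lambda>a. f (c a)) A"
    using assms(3,4) by (rule module_hom_finsum)
  then show ?thesis by (simp add: finsum_cong_add_monoid[of "self_module K" K])
qed

section \<open>Coordinates in a finite basis, and the double dual\<close>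

lemma basis_coordinates:
  assumes V: "vectorspace K V" and fin: "finite \<beta>" and \<beta>: "vectorspace.basis K V \<beta>"
  shows "\<exists>C. linear_iso K V (ring.func_space K \<beta>) C \<and>
    (\<forall>v\<in>carrier V. C v \<in> \<beta> \<rightarrow>\<^sub>E carrier K \<and> module.lincomb V (C v) \<beta> = v) \<and>
    (\<forall>a\<in>\<beta> \<rightarrow>\<^sub>E carrier K. C (module.lincomb V a \<beta>) = a)"
proof -
  interpret V: vectorspace K V by fact
  let ?F = "V.func_space \<beta>" and ?T = "\<lambda>a. V.lincomb a \<beta>"
  have sub: "\<beta> \<subseteq> carrier V" using \<beta> by (simp add: V.basis_def)
  have F: "carrier ?F = \<beta> \<rightarrow>\<^sub>E carrier K" by (simp add: V.func_space_def)
  \<comment> \<open>The basis property in the form of unique coefficients, extensional on \<beta>.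
    It makes the linear combination map a bijection from \<open>V.func_space \<beta>\<close>, and
    the coordinate map is the inverse.\<close>
  have ex1: "\<exists>!a. a \<in> \<beta> \<rightarrow>\<^sub>E carrier K \<and> ?T a = v" if "v \<in> carrier V" for v
    using V.basis_criterion[OF fin sub] \<beta> that by blast
  have cl: "?T a \<in> carrier V" if "a \<in> \<beta> \<rightarrow>\<^sub>E carrier K" for a
    using that sub by (intro V.lincomb_closed) auto
  have bij: "bij_betw ?T (carrier ?F) (carrier V)"
    unfolding bij_betw_def F
  proof
    show "inj_on ?T (\<beta> \<rightarrow>\<^sub>E carrier K)"
      using ex1 cl by (intro inj_onI) metis
    show "?T ` (\<beta> \<rightarrow>\<^sub>E carrier K) = carrier V"
      using ex1 cl by (auto simp: image_iff) metis
  qed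
  have T: "linear_iso K ?F V ?T"
    using V.lincomb_is_linear[OF fin sub] bij by (simp add: linear_iso_def)
  let ?C = "the_inv_into (carrier ?F) ?T"
  have "?C v \<in> carrier ?F \<and> ?T (?C v) = v" if "v \<in> carrier V" for v
    using bij that by (auto simp: f_the_inv_into_f_bij_betw[OF bij] bij_betw_def the_inv_into_into)
  moreover have "?C (?T a) = a" if "a \<in> carrier ?F" for a
    using bij that by (auto simp: bij_betw_def intro!: the_inv_into_f_f)
  ultimately show ?thesis
    using linear_iso_inverse[OF T] F by (intro exI[of _ ?C]) simp
qed

text \<open>Evaluation is injective because the coordinate functionals separate vectors, and
  surjective because a functional on the dual is determined by its values on the dual basis.\<close>

lemma double_dual_iso:
  assumes V: "vectorspace K V" and fd: "vectorspace.fin_dim K V"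
  shows "linear_iso K V (dual_space K (dual_space K V)) (\<lambda>v. \<lambda>f\<in>carrier (dual_space K V). f v)"
    (is "linear_iso K V ?DD ?ev")
proof (rule linear_isoI)
  interpret V: vectorspace K V by fact
  let ?D = "dual_space K V"
  have D: "vectorspace K ?D" using V by (rule dual_space_vectorspace)
  then interpret D: vectorspace K ?D .
  obtain \<beta> where fin: "finite \<beta>" and \<beta>: "V.basis \<beta>"
    using V.finite_basis_exists[OF fd] by blast
  have sub: "\<beta> \<subseteq> carrier V" using \<beta> by (simp add: V.basis_def)
  from basis_coordinates[OF V fin \<beta>] obtain C where
    C: "linear_iso K V (V.func_space \<beta>) C"
    and C_mem: "\<And>v. v \<in> carrier V \<Longrightarrow> C v \<in> \<beta> \<rightarrow>\<^sub>E carrier K"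
    and lin_C: "\<And>v. v \<in> carrier V \<Longrightarrow> V.lincomb (C v) \<beta> = v"
    and C_lin: "\<And>a. a \<in> \<beta> \<rightarrow>\<^sub>E carrier K \<Longrightarrow> C (V.lincomb a \<beta>) = a"
    by blast
  \<comment> \<open>The dual basis: \<open>\<delta> b\<close> reads off the coordinate at
    \<open>b\<close>.\<close>
  define \<delta> where "\<delta> b = (\<lambda>v\<in>carrier V. C v b)" for b
  have \<delta>: "\<delta> b \<in> carrier ?D" if "b \<in> \<beta>" for b
    using that linear_isoD(3)[OF C] C_mem
    by (intro dual_spaceI) (auto simp: \<delta>_def module_hom_def V.func_space_def PiE_mem)
  note K_mem = dual_space_apply(1)[of _ K V]
  have D_expand: "f v = (\<Oplus>\<^bsub>K\<^esub>b\<in>\<beta>. C v b \<otimes>\<^bsub>K\<^esub> f b)"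
    if f: "f \<in> carrier ?D" and v: "v \<in> carrier V" for f v
  proof -
    have "f v = f (V.lincomb (C v) \<beta>)" using v by (simp add: lin_C)
    also have "\<dots> = (\<Oplus>\<^bsub>K\<^esub>b\<in>\<beta>. f (C v b \<odot>\<^bsub>V\<^esub> b))"
      unfolding V.lincomb_def using sub C_mem[OF v]
      by (intro dual_space_apply_finsum[OF V f fin]) auto
    also have "\<dots> = (\<Oplus>\<^bsub>K\<^esub>b\<in>\<beta>. C v b \<otimes>\<^bsub>K\<^esub> f b)"
      using sub PiE_mem[OF C_mem[OF v]]
      by (intro V.R.finsum_cong') (auto simp: dual_space_apply[OF f] subset_iff)
    finally show ?thesis .
  qed
  \<comment> \<open>The functionals \<open>\<delta> b\<close> span the dual, with the values
    \<open>f b\<close> as coefficients; \<open>D_expand\<close> is this identity at a point.\<close>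
  have expand: "f = (\<Oplus>\<^bsub>?D\<^esub>b\<in>\<beta>. f b \<odot>\<^bsub>?D\<^esub> \<delta> b)" if f: "f \<in> carrier ?D" for f
  proof (rule extensionalityI[of _ "carrier V"])
    have cl: "(\<lambda>b. f b \<odot>\<^bsub>?D\<^esub> \<delta> b) \<in> \<beta> \<rightarrow> carrier ?D"
      using K_mem[OF f] \<delta> sub by (intro Pi_I D.smult_closed) auto
    show "(\<Oplus>\<^bsub>?D\<^esub>b\<in>\<beta>. f b \<odot>\<^bsub>?D\<^esub> \<delta> b) \<in> extensional (carrier V)"
      using D.M.finsum_closed[OF cl] by (rule dual_space_apply)
    show "f \<in> extensional (carrier V)" using f by (rule dual_space_apply)
    fix v assume v: "v \<in> carrier V"
    show "f v = (\<Oplus>\<^bsub>?D\<^esub>b\<in>\<beta>. f b \<odot>\<^bsub>?D\<^esub> \<delta> b) v"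
      unfolding dual_space_finsum_apply[OF V fin cl v] D_expand[OF f v]
      using v sub PiE_mem[OF C_mem[OF v]] K_mem[OF f]
      by (intro V.R.finsum_cong') (auto simp: \<delta>_def V.R.m_comm subset_iff)
  qed
  show DD: "vectorspace K ?DD" using D by (rule dual_space_vectorspace)
  have ev_cl: "?ev v \<in> carrier ?DD" if "v \<in> carrier V" for v
    using that D.M.add.m_closed D.smult_closed
    by (intro dual_spaceI) (auto simp: dual_space_apply)
  show "?ev \<in> module_hom K V ?DD"
    unfolding module_hom_def[of K V]
    using ev_cl by (auto simp: dual_space_apply intro!: restrict_ext)
  show "bij_betw ?ev (carrier V) (carrier ?DD)"
    unfolding bij_betw_def
  proof
    show "inj_on ?ev (carrier V)"
    proof (rule inj_onI)
      fix v w assume vw: "v \<in> carrier V" "w \<in> carrier V" "?ev v = ?ev w"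
      \<comment> \<open>Both evaluations are applied to the coordinate functional at
        \<open>b\<close>.\<close>
      have "C v b = C w b" if "b \<in> \<beta>" for b
        using fun_cong[OF vw(3), of "\<delta> b"] \<delta>[OF that] vw(1,2)
        by (simp add: \<delta>_def)
      then have "C v = C w"
        by (intro PiE_ext[OF C_mem[OF vw(1)] C_mem[OF vw(2)]])
      then show "v = w" using lin_C vw by metis
    qed
    show "?ev ` carrier V = carrier ?DD"
    proof (intro equalityI subsetI)
      fix F assume F: "F \<in> carrier ?DD"
      \<comment> \<open>The preimage of \<open>F\<close> must have coordinate
        \<open>F (\<delta> b)\<close> at \<open>b\<close>. The restriction to \<beta> makes
        \<open>a\<close> extensional, as \<open>C_lin\<close> demands.\<close>
      define a where "a = (\<lambda>b\<in>\<beta>. F (\<delta> b))"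
      have Fc: "F f \<in> carrier K" if "f \<in> carrier ?D" for f
        using F that by (rule dual_space_apply)
      have a: "a \<in> \<beta> \<rightarrow>\<^sub>E carrier K" using Fc \<delta> by (auto simp: a_def)
      let ?v = "V.lincomb a \<beta>"
      have v: "?v \<in> carrier V" using a sub by (intro V.lincomb_closed) auto
      have "?ev ?v = F"
      proof (rule extensionalityI[of _ "carrier ?D"])
        show "F \<in> extensional (carrier ?D)" using F by (rule dual_space_apply)
        fix f assume f: "f \<in> carrier ?D"
        have "F f = F (\<Oplus>\<^bsub>?D\<^esub>b\<in>\<beta>. f b \<odot>\<^bsub>?D\<^esub> \<delta> b)"
          using expand[OF f] by simp
        also have "\<dots> = (\<Oplus>\<^bsub>K\<^esub>b\<in>\<beta>. F (f b \<odot>\<^bsub>?D\<^esub> \<delta> b))"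
          using \<delta> sub K_mem[OF f]
          by (intro dual_space_apply_finsum[OF D F fin] Pi_I D.smult_closed) auto
        also have "\<dots> = (\<Oplus>\<^bsub>K\<^esub>b\<in>\<beta>. C ?v b \<otimes>\<^bsub>K\<^esub> f b)"
        proof (rule V.R.finsum_cong')
          fix b assume b: "b \<in> \<beta>"
          then have fb: "f b \<in> carrier K" using f sub K_mem by blast
          then have "F (f b \<odot>\<^bsub>?D\<^esub> \<delta> b) = f b \<otimes>\<^bsub>K\<^esub> F (\<delta> b)"
            using \<delta>[OF b] by (rule dual_space_apply[OF F])
          also have "\<dots> = C ?v b \<otimes>\<^bsub>K\<^esub> f b"
            unfolding C_lin[OF a] using b fb Fc[OF \<delta>[OF b]] by (simp add: a_def V.R.m_comm)
          finally show "F (f b \<odot>\<^bsub>?D\<^esub> \<delta> b) = C ?v b \<otimes>\<^bsub>K\<^esub> f b" .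
        qed (use PiE_mem[OF a] sub K_mem[OF f] in \<open>auto simp: C_lin[OF a] subset_iff\<close>)
        also have "\<dots> = f ?v" using D_expand[OF f v] by simp
        finally show "?ev ?v f = F f" using f by simp
      qed simp
      then show "F \<in> ?ev ` carrier V" using v by blast
    qed (use ev_cl in blast)
  qed
qed (fact V)


section \<open>Homogeneous projections for a grading by a finite group\<close>

locale finitely_graded_vector_space = graded_vector_space G K V
  for G :: "('g, 'a) monoid_scheme" (structure)
    and K :: "('k, 'b) ring_scheme"
    and V :: "('k, 'v, 'g, 'c) graded_space_scheme" +
  assumes finite_group: "finite (carrier G)"
begin

lemma component_submodule: "h \<in> carrier G \<Longrightarrow> submodule K (component V h) V"
  using component_subspace by (simp add: subspace_def)

lemma component_subset: "h \<in> carrier G \<Longrightarrow> component V h \<subseteq> carrier V"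
  using component_submodule by (rule submodule.subset)

lemma grade_vectorspace: "h \<in> carrier G \<Longrightarrow> vectorspace K (grade V h)"
  unfolding grade_def by (rule V.subspace_is_vs[OF component_subspace])

text \<open>The added summands are zero. Since \<open>carrier G\<close> is finite, decompositions
  can be restated with sums over this fixed index set, which no longer depends on the
  family.\<close>

lemma finsum_support:
  assumes "c \<in> (\<Pi> h\<in>carrier G. component V h)"
  shows "finsum V c {h \<in> carrier G. c h \<noteq> \<zero>\<^bsub>V\<^esub>} = finsum V c (carrier G)"
  using assms component_subset finite_group
  by (intro V.M.add.finprod_mono_neutral_cong_left) (auto simp: Pi_iff)

lemma ex1_decomposition:
  assumes "v \<in> carrier V"
  shows "\<exists>!c. c \<in> (\<Pi>\<^sub>E h\<in>carrier G. component V h) \<and> finsum V c (carrier G) = v"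
proof -
  have "c \<in> (\<Pi>\<^sub>E h\<in>carrier G. component V h) \<and> finite {h \<in> carrier G. c h \<noteq> \<zero>\<^bsub>V\<^esub>} \<and>
      finsum V c {h \<in> carrier G. c h \<noteq> \<zero>\<^bsub>V\<^esub>} = v \<longleftrightarrow>
    c \<in> (\<Pi>\<^sub>E h\<in>carrier G. component V h) \<and> finsum V c (carrier G) = v" for c
    using finsum_support[of c] finite_group by (auto simp: PiE_def)
  with direct_sum_components[OF assms] show ?thesis by simp
qed

text \<open>The projection of \<open>V\<close> onto its component of degree \<open>h\<close> along
  the other components.\<close>

definition homogeneous_part :: "'g \<Rightarrow> 'v \<Rightarrow> 'v"
  where "homogeneous_part h v =
    (THE c. c \<in> (\<Pi>\<^sub>E h\<in>carrier G. component V h) \<and> finsum V c (carrier G) = v) h"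

lemma
  assumes "v \<in> carrier V"
  shows homogeneous_part_closed: "h \<in> carrier G \<Longrightarrow> homogeneous_part h v \<in> component V h"
    and finsum_homogeneous_part: "(\<Oplus>\<^bsub>V\<^esub>h\<in>carrier G. homogeneous_part h v) = v"
  using theI'[OF ex1_decomposition[OF assms]] by (auto simp: homogeneous_part_def PiE_mem)

text \<open>Projections are computed by exhibiting a decomposition and using its uniqueness.
  Membership in the plain \<open>Pi\<close> admits families given by lambda terms; they are
  restricted to \<open>carrier G\<close> before uniqueness is applied.\<close>

lemma homogeneous_part_eqI:
  assumes "c \<in> (\<Pi> h\<in>carrier G. component V h)" and "finsum V c (carrier G) = v"
    and h: "h \<in> carrier G"
  shows "homogeneous_part h v = c h"
proof -
  have c: "c \<in> carrier G \<rightarrow> carrier V" using assms(1) component_subset by blast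
  then have v: "v \<in> carrier V" using assms(2) V.M.finsum_closed by blast
  have "finsum V (restrict c (carrier G)) (carrier G) = v"
    using c assms(2) V.M.finsum_cong'[of "carrier G" "carrier G" c "restrict c (carrier G)"] by simp
  moreover have "restrict c (carrier G) \<in> (\<Pi>\<^sub>E h\<in>carrier G. component V h)"
    using assms(1) by auto
  ultimately have "(THE c. c \<in> (\<Pi>\<^sub>E h\<in>carrier G. component V h) \<and> finsum V c (carrier G) = v)
      = restrict c (carrier G)"
    by (intro the1_equality[OF ex1_decomposition[OF v]]) simp
  with h show ?thesis by (simp add: homogeneous_part_def)
qed

lemma homogeneous_part_add:
  assumes "v \<in> carrier V" "w \<in> carrier V" "h \<in> carrier G"
  shows "homogeneous_part h (v \<oplus>\<^bsub>V\<^esub> w) = homogeneous_part h v \<oplus>\<^bsub>V\<^esub> homogeneous_part h w"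
proof (rule homogeneous_part_eqI)
  have "(\<lambda>h. homogeneous_part h u) \<in> carrier G \<rightarrow> carrier V" if "u \<in> carrier V" for u
    using homogeneous_part_closed[OF that] component_subset by blast
  then show "(\<Oplus>\<^bsub>V\<^esub>h\<in>carrier G. homogeneous_part h v \<oplus>\<^bsub>V\<^esub> homogeneous_part h w) = v \<oplus>\<^bsub>V\<^esub> w"
    using assms by (simp add: V.M.finsum_addf finsum_homogeneous_part)
qed (use assms homogeneous_part_closed component_submodule in \<open>auto intro: submodule.m_closed\<close>)

lemma homogeneous_part_smult:
  assumes "a \<in> carrier K" "v \<in> carrier V" "h \<in> carrier G"
  shows "homogeneous_part h (a \<odot>\<^bsub>V\<^esub> v) = a \<odot>\<^bsub>V\<^esub> homogeneous_part h v"
proof (rule homogeneous_part_eqI)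
  have "(\<lambda>h. homogeneous_part h v) \<in> carrier G \<rightarrow> carrier V"
    using homogeneous_part_closed[OF assms(2)] component_subset by blast
  then show "(\<Oplus>\<^bsub>V\<^esub>h\<in>carrier G. a \<odot>\<^bsub>V\<^esub> homogeneous_part h v) = a \<odot>\<^bsub>V\<^esub> v"
    using assms by (simp add: V.finsum_smult[symmetric] finsum_homogeneous_part)
qed (use assms homogeneous_part_closed component_submodule in \<open>auto intro: submodule.smult_closed\<close>)

lemma homogeneous_part_component:
  assumes v: "v \<in> component V k" and k: "k \<in> carrier G" and h: "h \<in> carrier G"
  shows "homogeneous_part h v = (if h = k then v else \<zero>\<^bsub>V\<^esub>)"
proof (rule homogeneous_part_eqI[OF _ _ h])
  show "(\<lambda>h. if h = k then v else \<zero>\<^bsub>V\<^esub>) \<in> (\<Pi> h\<in>carrier G. component V h)"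
    using v submodule.zero_closed[OF component_submodule] by auto
  show "(\<Oplus>\<^bsub>V\<^esub>h\<in>carrier G. if h = k then v else \<zero>\<^bsub>V\<^esub>) = v"
    using V.M.add.finprod_singleton_swap[OF k finite_group, of "\<lambda>_. v"] v component_subset[OF k]
    by auto
qed

section \<open>Functionals on a graded space and their degrees\<close>

lemma dual_eqI:
  assumes f: "f \<in> carrier (dual_space K V)" and f': "f' \<in> carrier (dual_space K V)"
    and eq: "\<And>h v. h \<in> carrier G \<Longrightarrow> v \<in> component V h \<Longrightarrow> f v = f' v"
  shows "f = f'"
proof (rule extensionalityI[of _ "carrier V"])
  fix v assume v: "v \<in> carrier V"
  have cl: "(\<lambda>h. homogeneous_part h v) \<in> carrier G \<rightarrow> carrier V"
    using homogeneous_part_closed[OF v] component_subset by blast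
  \<comment> \<open>A functional is the sum of its values on the homogeneous parts, so agreement on
    the components suffices.\<close>
  have *: "f v = (\<Oplus>\<^bsub>K\<^esub>h\<in>carrier G. f (homogeneous_part h v))"
    if "f \<in> carrier (dual_space K V)" for f
    using dual_space_apply_finsum[OF V.vectorspace_axioms that finite_group cl]
    by (simp add: finsum_homogeneous_part v)
  show "f v = f' v"
    unfolding *[OF f] *[OF f'] using homogeneous_part_closed[OF v] eq cl dual_space_apply(1)[OF f']
    by (intro V.R.finsum_cong') (auto simp: Pi_iff)
qed (rule dual_space_apply(4)[OF f] dual_space_apply(4)[OF f'])+

text \<open>Without its grading, the graded line is \<open>K\<close> as a space over itself. Hence
  \<open>g\<^sub>0\<close> affects only which functionals have a given degree, not the ambient space
  of functionals.\<close>

lemma hom_space_graded_line: "hom_space K V (graded_line K g\<^sub>0) = dual_space K V"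
  by (simp add: dual_space_def hom_space_def self_module_def graded_line_def module_hom_def)

lemma graded_dual_simps [simp]:
  "zero (graded_dual G K V g\<^sub>0) = zero (dual_space K V)"
  "add (graded_dual G K V g\<^sub>0) = add (dual_space K V)"
  "smult (graded_dual G K V g\<^sub>0) = smult (dual_space K V)"
  by (simp_all only: graded_dual_def graded_hom_def Let_def hom_space_graded_line
      graded_space.simps module.simps ring.simps monoid.simps partial_object.simps)

text \<open>A map of degree \<open>g\<close> sends the component of degree \<open>h\<close> into
  that of degree \<open>g \<otimes> h\<close> of the line, which is zero unless
  \<open>h = inv g \<otimes> g\<^sub>0\<close>; in that one case it is all of \<open>K\<close> and
  imposes no condition.\<close>

lemma component_graded_dual:
  assumes g: "g \<in> carrier G" "g\<^sub>0 \<in> carrier G"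
  shows "component (graded_dual G K V g\<^sub>0) g =
    {f \<in> carrier (dual_space K V).
      \<forall>h\<in>carrier G. h \<noteq> inv g \<otimes> g\<^sub>0 \<longrightarrow> (\<forall>v\<in>component V h. f v = \<zero>\<^bsub>K\<^esub>)}"
proof -
  have eq: "g \<otimes> h = g\<^sub>0 \<longleftrightarrow> h = inv g \<otimes> g\<^sub>0" if "h \<in> carrier G" for h
    using that g by (metis G.inv_closed G.inv_solve_left)
  have "component (graded_dual G K V g\<^sub>0) g = degree_homs G K V (graded_line K g\<^sub>0) g"
    by (simp add: graded_dual_def graded_hom_def Let_def)
  also have "\<dots> = {f \<in> carrier (dual_space K V).
      \<forall>h\<in>carrier G. f ` component V h \<subseteq> (if g \<otimes> h = g\<^sub>0 then carrier K else {\<zero>\<^bsub>K\<^esub>})}"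
    unfolding degree_homs_def hom_space_graded_line by (simp add: graded_line_def)
  also have "\<dots> = {f \<in> carrier (dual_space K V).
      \<forall>h\<in>carrier G. h \<noteq> inv g \<otimes> g\<^sub>0 \<longrightarrow> (\<forall>v\<in>component V h. f v = \<zero>\<^bsub>K\<^esub>)}"
    using component_subset by (intro Collect_cong) (auto simp: eq dual_space_apply(1) subset_iff)
  finally show ?thesis .
qed

lemma dual_vectorspace: "vectorspace K (dual_space K V)"
  by (rule dual_space_vectorspace) (rule V.vectorspace_axioms)

sublocale D: vectorspace K "dual_space K V"
  by (rule dual_vectorspace)

lemma component_graded_dual_submodule:
  assumes g: "g \<in> carrier G" "g\<^sub>0 \<in> carrier G"
  shows "submodule K (component (graded_dual G K V g\<^sub>0) g) (dual_space K V)"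
proof (rule submodule.intro)
  have V_mem: "v \<in> carrier V" if "h \<in> carrier G" "v \<in> component V h" for h v
    using that component_subset by blast
  note mem = component_graded_dual[OF g]
  show "module K (dual_space K V)" ..
  show "component (graded_dual G K V g\<^sub>0) g \<subseteq> carrier (dual_space K V)"
    by (auto simp: mem)
  show "\<zero>\<^bsub>dual_space K V\<^esub> \<in> component (graded_dual G K V g\<^sub>0) g"
    using D.M.zero_closed by (auto simp: mem V_mem)
  fix f assume f: "f \<in> component (graded_dual G K V g\<^sub>0) g"
  show "f \<oplus>\<^bsub>dual_space K V\<^esub> f' \<in> component (graded_dual G K V g\<^sub>0) g"
    if "f' \<in> component (graded_dual G K V g\<^sub>0) g" for f'
    using f that D.M.add.m_closed[of f f'] by (auto simp: mem V_mem)
  show "a \<odot>\<^bsub>dual_space K V\<^esub> f \<in> component (graded_dual G K V g\<^sub>0) g" if "a \<in> carrier K" for a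
    using f that D.smult_closed[of a f] by (auto simp: mem V_mem)
qed

lemma carrier_graded_dual:
  "carrier (graded_dual G K V g\<^sub>0) =
    D.span (\<Union>g\<in>carrier G. component (graded_dual G K V g\<^sub>0) g)"
  by (simp add: graded_dual_def graded_hom_def Let_def hom_space_graded_line)

text \<open>Composition with the homogeneous projection extends \<phi> by zero to the other
  components. This is the future inverse of restriction.\<close>

lemma dual_extension:
  assumes g: "g \<in> carrier G" "g\<^sub>0 \<in> carrier G"
    and \<phi>: "\<phi> \<in> carrier (dual_space K (grade V (inv g \<otimes> g\<^sub>0)))"
  shows "(\<lambda>v\<in>carrier V. \<phi> (homogeneous_part (inv g \<otimes> g\<^sub>0) v))
    \<in> component (graded_dual G K V g\<^sub>0) g"
proof -
  let ?k = "inv g \<otimes> g\<^sub>0"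
  have k: "?k \<in> carrier G" using g by simp
  have grade: "carrier (grade V ?k) = component V ?k" "add (grade V ?k) = add V"
    "zero (grade V ?k) = zero V" "smult (grade V ?k) = smult V"
    by (simp_all add: grade_def)
  note \<phi>' = dual_space_apply[OF \<phi>, unfolded grade]
  have "(\<lambda>v\<in>carrier V. \<phi> (homogeneous_part ?k v)) \<in> carrier (dual_space K V)"
    using k by (intro dual_spaceI)
      (auto simp: \<phi>' homogeneous_part_add homogeneous_part_smult homogeneous_part_closed)
  moreover have "\<phi> (homogeneous_part ?k v) = \<zero>\<^bsub>K\<^esub>"
    if "h \<in> carrier G" "h \<noteq> ?k" "v \<in> component V h" for h v
    using dual_space_apply_zero[OF grade_vectorspace[OF k] \<phi>] that k
    by (simp add: grade homogeneous_part_component)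
  ultimately show ?thesis
    using component_subset by (auto simp: component_graded_dual[OF g] subset_iff)
qed

lemma dual_restriction:
  assumes f: "f \<in> carrier (dual_space K V)" and k: "k \<in> carrier G"
  shows "restrict f (component V k) \<in> carrier (dual_space K (grade V k))"
proof -
  interpret submodule K "component V k" V using k by (rule component_submodule)
  show ?thesis
    using subset by (intro dual_spaceI) (auto simp: grade_def dual_space_apply[OF f] subset_iff)
qed

text \<open>Injectivity of restriction: both functionals vanish on every other component, and
  functionals are compared component by component.\<close>

lemma component_graded_dual_eqI:
  assumes g: "g \<in> carrier G" "g\<^sub>0 \<in> carrier G"
    and "f \<in> component (graded_dual G K V g\<^sub>0) g" "f' \<in> component (graded_dual G K V g\<^sub>0) g"
    and "\<And>v. v \<in> component V (inv g \<otimes> g\<^sub>0) \<Longrightarrow> f v = f' v"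
  shows "f = f'"
proof (rule dual_eqI)
  fix h v assume "h \<in> carrier G" "v \<in> component V h"
  then show "f v = f' v"
    using assms by (cases "h = inv g \<otimes> g\<^sub>0") (auto simp: component_graded_dual)
qed (use assms in \<open>auto simp: component_graded_dual\<close>)

text \<open>The map sending \<open>h\<close> to \<open>inv h \<otimes> g\<^sub>0\<close> is
  injective, so every summand of degree other than \<open>g\<close> vanishes at
  \<open>v\<close>.\<close>

lemma finsum_graded_dual_apply:
  assumes g: "g \<in> carrier G" "g\<^sub>0 \<in> carrier G"
    and c: "c \<in> (\<Pi> g\<in>carrier G. component (graded_dual G K V g\<^sub>0) g)"
    and v: "v \<in> component V (inv g \<otimes> g\<^sub>0)"
  shows "finsum (dual_space K V) c (carrier G) v = c g v"
proof -
  have cD: "c \<in> carrier G \<rightarrow> carrier (dual_space K V)"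
    using c g component_graded_dual by auto
  have vV: "v \<in> carrier V" using v g component_subset[of "inv g \<otimes> g\<^sub>0"] by auto
  have "c h v = (if h = g then c h v else \<zero>\<^bsub>K\<^esub>)" if h: "h \<in> carrier G" for h
  proof (cases "h = g")
    case False
    then have "inv g \<otimes> g\<^sub>0 \<noteq> inv h \<otimes> g\<^sub>0"
      using g h by (metis G.inv_closed G.inv_inv G.right_cancel)
    moreover have "inv g \<otimes> g\<^sub>0 \<in> carrier G" using g by simp
    moreover have "c h \<in> component (graded_dual G K V g\<^sub>0) h" using c h by blast
    ultimately show ?thesis
      using v False unfolding component_graded_dual[OF h g(2)] by auto
  qed simp
  then have "(\<Oplus>\<^bsub>K\<^esub>h\<in>carrier G. c h v) = (\<Oplus>\<^bsub>K\<^esub>h\<in>carrier G. if h = g then c h v else \<zero>\<^bsub>K\<^esub>)"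
    using cD vV by (intro V.R.finsum_cong') (auto simp: dual_space_apply(1) Pi_iff)
  also have "\<dots> = c g v"
    using cD vV g finite_group
    by (intro V.R.add.finprod_singleton_swap) (auto simp: dual_space_apply(1) Pi_iff)
  finally show ?thesis
    by (simp add: dual_space_finsum_apply[OF V.vectorspace_axioms finite_group cD vV])
qed

section \<open>The graded dual is graded again\<close>

lemma ex1_dual_decomposition:
  assumes g\<^sub>0: "g\<^sub>0 \<in> carrier G" and f: "f \<in> carrier (dual_space K V)"
  shows "\<exists>!c. c \<in> (\<Pi>\<^sub>E g\<in>carrier G. component (graded_dual G K V g\<^sub>0) g) \<and>
    finsum (dual_space K V) c (carrier G) = f"
proof -
  \<comment> \<open>The part of degree \<open>g\<close> is \<open>f\<close> cut down to the
    component of degree \<open>inv g \<otimes> g\<^sub>0\<close> and extended by zero.\<close>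
  define c where "c = (\<lambda>g\<in>carrier G. \<lambda>v\<in>carrier V.
    restrict f (component V (inv g \<otimes> g\<^sub>0)) (homogeneous_part (inv g \<otimes> g\<^sub>0) v))"
  have c: "c g \<in> component (graded_dual G K V g\<^sub>0) g" if "g \<in> carrier G" for g
    using dual_extension[OF that g\<^sub>0 dual_restriction[OF f]] that g\<^sub>0 by (simp add: c_def)
  then have cE: "c \<in> (\<Pi>\<^sub>E g\<in>carrier G. component (graded_dual G K V g\<^sub>0) g)"
    by (auto simp: c_def)
  have c_apply: "c g v = f v" if g: "g \<in> carrier G" and v: "v \<in> component V (inv g \<otimes> g\<^sub>0)" for g v
    using g v g\<^sub>0 component_subset[of "inv g \<otimes> g\<^sub>0"]
    by (auto simp: c_def homogeneous_part_component)
  have eq: "finsum (dual_space K V) c (carrier G) = f"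
  proof (rule dual_eqI)
    show "finsum (dual_space K V) c (carrier G) \<in> carrier (dual_space K V)"
      using c g\<^sub>0 by (intro D.M.finsum_closed) (auto simp: component_graded_dual)
    fix h v assume h: "h \<in> carrier G" and v: "v \<in> component V h"
    \<comment> \<open>The solution of \<open>inv ?g \<otimes> g\<^sub>0 = h\<close>: the one degree
      whose summand is seen on the component of degree \<open>h\<close>.\<close>
    let ?g = "g\<^sub>0 \<otimes> inv h"
    have g: "?g \<in> carrier G" using g\<^sub>0 h by simp
    have "inv ?g \<otimes> g\<^sub>0 = h"
      using g\<^sub>0 h by (simp add: G.inv_mult_group G.m_assoc)
    then have v': "v \<in> component V (inv ?g \<otimes> g\<^sub>0)" using v by simp
    show "finsum (dual_space K V) c (carrier G) v = f v"
      using finsum_graded_dual_apply[OF g g\<^sub>0 _ v', of c] c_apply[OF g v'] c by auto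
  qed (rule f)
  have "c' = c" if c': "c' \<in> (\<Pi>\<^sub>E g\<in>carrier G. component (graded_dual G K V g\<^sub>0) g)"
    and sum: "finsum (dual_space K V) c' (carrier G) = f" for c'
  proof (rule PiE_ext[OF c' cE])
    fix g assume g: "g \<in> carrier G"
    \<comment> \<open>On this component the whole sum \<open>f\<close> equals its summand of degree
      \<open>g\<close>, for either decomposition; a functional of degree \<open>g\<close> is
      determined there.\<close>
    have "c' g v = c g v" if v: "v \<in> component V (inv g \<otimes> g\<^sub>0)" for v
      using finsum_graded_dual_apply[OF g g\<^sub>0 _ v, of c'] c' sum c_apply[OF g v]
      by (auto simp: PiE_def)
    then show "c' g = c g"
      using component_graded_dual_eqI[OF g g\<^sub>0 PiE_mem[OF c' g] c[OF g]] by blast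
  qed
  with cE eq show ?thesis by blast
qed

text \<open>Each functional is a sum, over the finite group, of homogeneous ones, so their span is
  the whole dual space.\<close>

lemma carrier_graded_dual_eq_dual:
  assumes "g\<^sub>0 \<in> carrier G"
  shows "carrier (graded_dual G K V g\<^sub>0) = carrier (dual_space K V)"
proof
  let ?U = "\<Union>g\<in>carrier G. component (graded_dual G K V g\<^sub>0) g"
  have U: "?U \<subseteq> carrier (dual_space K V)"
    using assms by (auto simp: component_graded_dual)
  show "carrier (graded_dual G K V g\<^sub>0) \<subseteq> carrier (dual_space K V)"
    unfolding carrier_graded_dual using U by (rule D.span_is_subset2)
  show "carrier (dual_space K V) \<subseteq> carrier (graded_dual G K V g\<^sub>0)"
  proof
    fix f assume "f \<in> carrier (dual_space K V)"
    with assms obtain c where c: "c \<in> (\<Pi>\<^sub>E g\<in>carrier G. component (graded_dual G K V g\<^sub>0) g)"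
      and f: "finsum (dual_space K V) c (carrier G) = f"
      using ex1_dual_decomposition by blast
    have "c \<in> carrier G \<rightarrow> D.span ?U"
      using c D.in_own_span[OF U] by blast
    from submodule_finsum_closed[OF D.span_is_submodule[OF U] finite_group this]
    show "f \<in> carrier (graded_dual G K V g\<^sub>0)"
      unfolding f carrier_graded_dual .
  qed
qed

text \<open>This closes the locale under graded duals, so that all its results apply to the graded
  dual itself and the construction can be iterated.\<close>

lemma graded_dual_finitely_graded:
  assumes g\<^sub>0: "g\<^sub>0 \<in> carrier G"
  shows "finitely_graded_vector_space G K (graded_dual G K V g\<^sub>0)"
proof -
  let ?X = "graded_dual G K V g\<^sub>0"
  note car = carrier_graded_dual_eq_dual[OF g\<^sub>0]
  have X: "vectorspace K ?X"
    using dual_vectorspace car by (rule vectorspace_cong) simp_all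
  interpret X: vectorspace K ?X by (rule X)
  show ?thesis
  proof (intro finitely_graded_vector_space.intro graded_vector_space.intro X
      graded_vector_space_axioms.intro finitely_graded_vector_space_axioms.intro finite_group)
    show "group G" ..
  next
    fix g assume g: "g \<in> carrier G"
    interpret submodule K "component ?X g" "dual_space K V"
      using g g\<^sub>0 by (rule component_graded_dual_submodule)
    have "submodule K (component ?X g) ?X"
      using subset m_closed zero_closed smult_closed X.module_axioms
      by (intro submodule.intro) (simp_all add: car)
    then show "subspace K (component ?X g) ?X"
      using X by (simp add: subspace_def)
  next
    fix f assume f: "f \<in> carrier ?X"
    \<comment> \<open>The decomposition axiom sums over supports inside \<open>?X\<close>; it is
      translated into sums over \<open>carrier G\<close> inside the dual space, where existence and
      uniqueness are known.\<close>
    have "c \<in> (\<Pi>\<^sub>E g\<in>carrier G. component ?X g) \<and> finite {g \<in> carrier G. c g \<noteq> \<zero>\<^bsub>?X\<^esub>} \<and>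
        finsum ?X c {g \<in> carrier G. c g \<noteq> \<zero>\<^bsub>?X\<^esub>} = f \<longleftrightarrow>
      c \<in> (\<Pi>\<^sub>E g\<in>carrier G. component ?X g) \<and> finsum (dual_space K V) c (carrier G) = f" for c
    proof -
      have "finsum ?X c {g \<in> carrier G. c g \<noteq> \<zero>\<^bsub>?X\<^esub>} = finsum (dual_space K V) c (carrier G)"
        if "c \<in> (\<Pi>\<^sub>E g\<in>carrier G. component ?X g)"
      proof -
        have "finsum ?X c {g \<in> carrier G. c g \<noteq> \<zero>\<^bsub>?X\<^esub>} = finsum ?X c (carrier G)"
          using that g\<^sub>0 finite_group
          by (intro X.M.add.finprod_mono_neutral_cong_left)
            (auto simp: car component_graded_dual PiE_def Pi_iff)
        also have "\<dots> = finsum (dual_space K V) c (carrier G)"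
          by (intro finsum_cong_add_monoid) (simp_all add: car)
        finally show ?thesis .
      qed
      then show ?thesis using finite_group by auto
    qed
    with ex1_dual_decomposition[OF g\<^sub>0, of f] f
    show "\<exists>!c. c \<in> (\<Pi>\<^sub>E g\<in>carrier G. component ?X g) \<and> finite {g \<in> carrier G. c g \<noteq> \<zero>\<^bsub>?X\<^esub>} \<and>
        finsum ?X c {g \<in> carrier G. c g \<noteq> \<zero>\<^bsub>?X\<^esub>} = f"
      by (simp add: car)
  qed
qed

section \<open>Restriction to one component, applied once and twice\<close>

lemma graded_dual_component_iso:
  assumes g: "g \<in> carrier G" "g\<^sub>0 \<in> carrier G"
  shows "linear_iso K (grade (graded_dual G K V g\<^sub>0) g) (dual_space K (grade V (inv g \<otimes> g\<^sub>0)))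
    (\<lambda>f. restrict f (component V (inv g \<otimes> g\<^sub>0)))"
proof (rule linear_isoI)
  let ?X = "graded_dual G K V g\<^sub>0" and ?k = "inv g \<otimes> g\<^sub>0"
  interpret X: finitely_graded_vector_space G K ?X
    using g(2) by (rule graded_dual_finitely_graded)
  have k: "?k \<in> carrier G" using g by simp
  have D_mem: "f \<in> carrier (dual_space K V)" if "f \<in> component ?X g" for f
    using that by (simp add: component_graded_dual[OF g])
  have V_mem: "v \<in> carrier V" if "v \<in> component V ?k" for v
    using that component_subset[OF k] by blast
  show "vectorspace K (grade ?X g)" using g(1) by (rule X.grade_vectorspace)
  show "vectorspace K (dual_space K (grade V ?k))"
    by (intro dual_space_vectorspace grade_vectorspace k)
  show "(\<lambda>f. restrict f (component V ?k)) \<in> module_hom K (grade ?X g) (dual_space K (grade V ?k))"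
    using dual_restriction[OF D_mem k] V_mem by (auto simp: module_hom_def grade_def)
  show "bij_betw (\<lambda>f. restrict f (component V ?k)) (carrier (grade ?X g))
    (carrier (dual_space K (grade V ?k)))"
  \<comment> \<open>The inverse is extension by zero.\<close>
  proof (rule bij_betw_byWitness[where f' = "\<lambda>\<phi>. \<lambda>v\<in>carrier V. \<phi> (homogeneous_part ?k v)"])
    show "\<forall>f\<in>carrier (grade ?X g).
      (\<lambda>v\<in>carrier V. restrict f (component V ?k) (homogeneous_part ?k v)) = f"
    proof
      fix f assume "f \<in> carrier (grade ?X g)"
      then have f: "f \<in> component ?X g" by (simp add: grade_def)
      show "(\<lambda>v\<in>carrier V. restrict f (component V ?k) (homogeneous_part ?k v)) = f"
        \<comment> \<open>The re-extension has degree \<open>g\<close>, like \<open>f\<close>, and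
          agrees with it on the component of degree \<open>?k\<close>.\<close>
        using dual_extension[OF g dual_restriction[OF D_mem[OF f] k]] f
        by (rule component_graded_dual_eqI[OF g]) (simp add: V_mem homogeneous_part_component k)
    qed
    show "\<forall>\<phi>\<in>carrier (dual_space K (grade V ?k)).
      restrict (\<lambda>v\<in>carrier V. \<phi> (homogeneous_part ?k v)) (component V ?k) = \<phi>"
    proof
      fix \<phi> assume "\<phi> \<in> carrier (dual_space K (grade V ?k))"
      then have "\<phi> \<in> extensional (component V ?k)"
        using dual_space_apply(4)[of \<phi> K "grade V ?k"] by (simp add: grade_def)
      then show "restrict (\<lambda>v\<in>carrier V. \<phi> (homogeneous_part ?k v)) (component V ?k) = \<phi>"
        by (intro extensionalityI[of _ "component V ?k"])
          (auto simp: V_mem homogeneous_part_component k)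
    qed
    show "(\<lambda>f. restrict f (component V ?k)) ` carrier (grade ?X g) \<subseteq> carrier (dual_space K (grade V ?k))"
      using dual_restriction[OF D_mem k] by (auto simp: grade_def)
    show "(\<lambda>\<phi>. \<lambda>v\<in>carrier V. \<phi> (homogeneous_part ?k v)) ` carrier (dual_space K (grade V ?k))
      \<subseteq> carrier (grade ?X g)"
      using dual_extension[OF g] by (auto simp: grade_def)
  qed
qed

end

theorem lemma4p2p4:
  fixes G :: "('g, 'a) monoid_scheme" (structure)
    and K :: "('k, 'b) ring_scheme"
    and V :: "('k, 'v, 'g, 'c) graded_space_scheme"
    and g g\<^sub>0 g\<^sub>1 :: 'g
  assumes "group G" and "finite (carrier G)" and "field K"
    and "graded_vector_space G K V"
    and "g \<in> carrier G" and "g\<^sub>0 \<in> carrier G" and "g\<^sub>1 \<in> carrier G"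
  shows "linear_iso K (grade (graded_dual G K V g\<^sub>0) g) (dual_space K (grade V (inv g \<otimes> g\<^sub>0)))
           (\<lambda>f. restrict f (component V (inv g \<otimes> g\<^sub>0)))
       \<and> (fin_dim_graded G K V \<longrightarrow>
           (\<exists>\<phi>. linear_iso K (grade (graded_dual G K (graded_dual G K V g\<^sub>0) g\<^sub>1) g)
                  (grade V (inv g\<^sub>1 \<otimes> g \<otimes> g\<^sub>0)) \<phi>))"
proof (intro conjI impI)
  note g = assms(5-7)
  interpret finitely_graded_vector_space G K V
    using assms by (simp add: finitely_graded_vector_space_def finitely_graded_vector_space_axioms_def)
  show "linear_iso K (grade (graded_dual G K V g\<^sub>0) g) (dual_space K (grade V (inv g \<otimes> g\<^sub>0)))
      (\<lambda>f. restrict f (component V (inv g \<otimes> g\<^sub>0)))"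
    using g(1,2) by (rule graded_dual_component_iso)
  assume fin_dim: "fin_dim_graded G K V"
  let ?X = "graded_dual G K V g\<^sub>0" and ?k = "inv g \<otimes> g\<^sub>1" and ?h = "inv g\<^sub>1 \<otimes> g \<otimes> g\<^sub>0"
  interpret X: finitely_graded_vector_space G K ?X
    using g(2) by (rule graded_dual_finitely_graded)
  have k: "?k \<in> carrier G" and h: "?h \<in> carrier G" using g by simp_all
  \<comment> \<open>The two shifts compose: degree \<open>g\<close> of the double graded dual is
    dual to degree \<open>?k\<close> of \<open>?X\<close>, which is dual to degree \<open>?h\<close>
    of \<open>V\<close>.\<close>
  have kh: "inv ?k \<otimes> g\<^sub>0 = ?h"
    using g by (simp add: G.inv_mult_group)
  note to_dual = X.graded_dual_component_iso[OF g(1,3)]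
  \<comment> \<open>Transposition reverses arrows, so the inverse of restriction is transposed to
    obtain a map from the dual of \<open>grade ?X ?k\<close> to the double dual of
    \<open>grade V ?h\<close>.\<close>
  note to_double_dual = linear_iso_dual[OF linear_iso_inverse[OF
        graded_dual_component_iso[OF k g(2), unfolded kh]]]
  have eval: "linear_iso K (grade V ?h) (dual_space K (dual_space K (grade V ?h)))
      (\<lambda>v. \<lambda>f\<in>carrier (dual_space K (grade V ?h)). f v)"
    \<comment> \<open>Finite dimensionality enters here, for the single component of degree
      \<open>?h\<close>.\<close>
    using fin_dim h by (intro double_dual_iso grade_vectorspace) (simp_all add: fin_dim_graded_def)
  show "\<exists>\<phi>. linear_iso K (grade (graded_dual G K ?X g\<^sub>1) g) (grade V ?h) \<phi>"
    by (rule exI) (rule linear_iso_trans[OF linear_iso_trans[OF to_dual to_double_dual]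
          linear_iso_inverse[OF eval]])
qed

end
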